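(* Let $\mathcal{S}\in\mathbb{C}^{p\times q\times n}$ and $\mathcal{T}\in\mathbb{C}^{k\times p\times n}$, and let $(\mathcal{T}*\mathcal{S})^{(1)}$ be an arbitrary fixed element of $(\mathcal{T}*\mathcal{S})\{1\}$. Assume that the following conditions hold: (a) there exists $\mathcal{X}\in\mathbb{C}^{q\times p\times n}$ with $\mathcal{X}*\mathcal{S}*\mathcal{X}=\mathcal{X}$ and $\mathscr{N}(\mathcal{X})=\mathscr{N}(\mathcal{T})$; (b) $\mathcal{T}=\mathcal{T}*\mathcal{S}*\mathcal{Z}*\mathcal{T}$ for some $\mathcal{Z}\in\mathbb{C}^{q\times k\times n}$; (c) $\mathscr{R}(\mathcal{T}*\mathcal{S})=\mathscr{R}(\mathcal{T})$; (d) $\mathcal{T}=\mathcal{T}*\mathcal{S}*(\mathcal{T}*\mathcal{S})^{(1)}*\mathcal{T}$; (e) $\mathrm{rank}_t(\mathcal{T}*\mathcal{S})=\mathrm{rank}_t(\mathcal{T})$. Then the set $\mathcal{S}\{2\}_{*,\mathscr{N}(\mathcal{T})}$ has the following representations: (i) $\mathcal{S}\{2\}_{*,\mathscr{N}(\mathcal{T})}=\{\mathcal{Y}*\mathcal{T} : \mathcal{Y}\in(\mathcal{T}*\mathcal{S})\{1\}\}=\{\mathcal{Z}*\mathcal{T} : \mathcal{Z}\in\mathbb{C}^{q\times k\times n},\ \mathcal{T}*\mathcal{S}*\mathcal{Z}*\mathcal{T}=\mathcal{T}\}$. (ii) $\mathcal{S}\{2\}_{*,\mathscr{N}(\mathcal{T})}=\{(\mathcal{T}*\mathcal{S})^{(1)}*\mathcal{T}+\mathcal{Z}*\mathcal{T}-(\mathcal{T}*\mathcal{S})^{(1)}*\mathcal{T}*\mathcal{S}*\mathcal{Z}*\mathcal{T}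 : \mathcal{Z}\in\mathbb{C}^{q\times k\times n}\}$.
   Context: A third-order tensor $\mathcal{A}\in\mathbb{C}^{a\times b\times n}$ has frontal slices $A_1,\dots,A_n\in\mathbb{C}^{a\times b}$, $A_k=\mathcal{A}(:,:,k)$. $\mathrm{bcirc}(\mathcal{A})\in\mathbb{C}^{an\times bn}$ is the block circulant matrix whose $(i,j)$ block ($1\le i,j\le n$) is $A_{((i-j)\bmod n)+1}$. For $\mathcal{A}\in\mathbb{C}^{a\times b\times n}$ and $\mathcal{B}\in\mathbb{C}^{b\times c\times n}$, the $t$-product $\mathcal{A}*\mathcal{B}\in\mathbb{C}^{a\times c\times n}$ is the unique tensor with $\mathrm{bcirc}(\mathcal{A}*\mathcal{B})=\mathrm{bcirc}(\mathcal{A})\,\mathrm{bcirc}(\mathcal{B})$. The $t$-range space $\mathscr{R}(\mathcal{A})$ is the range (column space) of $\mathrm{bcirc}(\mathcal{A})$, the $t$-null space $\mathscr{N}(\mathcal{A})$ is the null space of $\mathrm{bcirc}(\mathcal{A})$, and $\mathrm{rank}_t(\mathcal{A})=\mathrm{rank}(\mathrm{bcirc}(\mathcal{A}))$. For $\mathcal{A}\in\mathbb{C}^{a\times b\times n}$, $\mathcal{A}\{1\}$ is the set of $\mathcal{X}\in\mathbb{C}^{b\times a\times n}$ with $\mathcal{A}*\mathcal{X}*\mathcal{A}=\mathcal{A}$. The set $\mathcal{S}\{2\}_{*,\mathscr{N}(\mathcal{T})}$ consists of all $\mathcal{X}\in\mathbb{C}^{q\times p\times n}$ with $\mathcal{X}*\mathcal{S}*\mathcal{X}=\mathcal{X}$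 and $\mathscr{N}(\mathcal{X})=\mathscr{N}(\mathcal{T})$. *)

theory Defs
  imports "Jordan_Normal_Form.DL_Rank" "Jordan_Normal_Form.Matrix_Kernel"
begin

text \<open>
  A complex third-order tensor is represented by the list of its frontal slices, and
  \<open>tensors a b n\<close> is the space of \<open>a \<times> b \<times> n\<close> tensors. Slices, blocks and entries are numbered
  from \<open>0\<close>. The functions \<open>trows\<close>, \<open>tcols\<close> and \<open>bcirc\<close> read the slice dimensions off the first
  slice, so they are meaningful only for \<open>n > 0\<close>.
\<close>

type_synonym tensor = "complex mat list"

definition tensors :: "nat \<Rightarrow> nat \<Rightarrow> nat \<Rightarrow> tensor set" where
  "tensors a b n = {A. length A = n \<and> set A \<subseteq> carrier_mat a b}"

definition trows :: "tensor \<Rightarrow> nat" where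
  "trows A = dim_row (A ! 0)"

definition tcols :: "tensor \<Rightarrow> nat" where
  "tcols A = dim_col (A ! 0)"

text \<open>
  Row \<open>i\<close> lies in block row \<open>i div a\<close> at offset \<open>i mod a\<close>, and likewise for columns. Adding \<open>n\<close>
  before subtracting keeps the block difference from being truncated on \<^typ>\<open>nat\<close>.
\<close>

definition bcirc :: "tensor \<Rightarrow> complex mat" where
  "bcirc A = (let a = trows A; b = tcols A; n = length A in
     mat (a * n) (b * n)
       (\<lambda>(i, j). A ! ((i div a + n - j div b) mod n) $$ (i mod a, j mod b)))"

definition tprod :: "tensor \<Rightarrow> tensor \<Rightarrow> tensor" (infixl "*\<^sub>t" 70) where
  "A *\<^sub>t B = (THE C. C \<in> tensors (trows A) (tcols B) (length A) \<and>
                    bcirc C = bcirc A * bcirc B)"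

definition tadd :: "tensor \<Rightarrow> tensor \<Rightarrow> tensor" (infixl "+\<^sub>t" 65) where
  "A +\<^sub>t B = map2 (+) A B"

definition tdiff :: "tensor \<Rightarrow> tensor \<Rightarrow> tensor" (infixl "-\<^sub>t" 65) where
  "A -\<^sub>t B = map2 (-) A B"

definition t_range :: "tensor \<Rightarrow> complex vec set" where
  "t_range A = vec_space.col_space (dim_row (bcirc A)) (bcirc A)"

definition t_null :: "tensor \<Rightarrow> complex vec set" where
  "t_null A = mat_kernel (bcirc A)"

definition t_rank :: "tensor \<Rightarrow> nat" where
  "t_rank A = vec_space.rank (dim_row (bcirc A)) (bcirc A)"

definition one_inverses :: "tensor \<Rightarrow> tensor set" where
  "one_inverses A = {X \<in> tensors (tcols A) (trows A) (length A). A *\<^sub>t X *\<^sub>t A = A}"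

definition two_inverses_null :: "tensor \<Rightarrow> tensor \<Rightarrow> tensor set" where
  "two_inverses_null S T =
     {X \<in> tensors (tcols S) (trows S) (length S). X *\<^sub>t S *\<^sub>t X = X \<and> t_null X = t_null T}"

text \<open>
  The description in the definition of \<open>*\<^sub>t\<close> determines a unique tensor whenever the
  dimensions match.
\<close>

lemma tensorsD:
  assumes "A \<in> tensors a b n" "0 < n"
  shows "length A = n" "trows A = a" "tcols A = b" "\<And>k. k < n \<Longrightarrow> A ! k \<in> carrier_mat a b"
proof -
  show l: "length A = n" and s: "\<And>k. k < n \<Longrightarrow> A ! k \<in> carrier_mat a b"
    using assms(1) unfolding tensors_def by auto
  show "trows A = a" "tcols A = b"
    using s[OF assms(2)] unfolding trows_def tcols_def by auto
qed

lemma bcirc_carrier: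
  assumes "A \<in> tensors a b n" "0 < n"
  shows "bcirc A \<in> carrier_mat (a * n) (b * n)"
  using tensorsD[OF assms] by (simp add: bcirc_def Let_def)

lemma bcirc_index:
  assumes "A \<in> tensors a b n" "0 < n" "i < a * n" "j < b * n"
  shows "bcirc A $$ (i, j) = A ! ((i div a + n - j div b) mod n) $$ (i mod a, j mod b)"
  using tensorsD[OF assms(1,2)] assms(3,4) by (simp add: bcirc_def Let_def)

lemma block_index_less:
  fixes k i a n :: nat
  assumes "k < n" "i < a"
  shows "k * a + i < a * n"
proof -
  have "k * a + i < Suc k * a" using assms(2) by simp
  also have "\<dots> \<le> n * a" using assms(1) by (intro mult_le_mono1) simp
  finally show ?thesis by (simp add: mult.commute)
qed

lemma bcirc_inj:
  assumes A: "A \<in> tensors a b n" and B: "B \<in> tensors a b n" and n: "0 < n"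
    and eq: "bcirc A = bcirc B"
  shows "A = B"
proof (rule nth_equalityI)
  show "length A = length B" using tensorsD(1)[OF A n] tensorsD(1)[OF B n] by simp
  fix k assume "k < length A"
  hence k: "k < n" using tensorsD(1)[OF A n] by simp
  show "A ! k = B ! k"
  proof (rule eq_matI)
    fix i j assume "i < dim_row (B ! k)" "j < dim_col (B ! k)"
    hence i: "i < a" and j: "j < b" using tensorsD(4)[OF B n k] by auto
    have ik: "k * a + i < a * n" using block_index_less[OF k i] .
    have j0: "j < b * n" using block_index_less[OF n j] by simp
    show "A ! k $$ (i, j) = B ! k $$ (i, j)"
      using bcirc_index[OF A n ik j0] bcirc_index[OF B n ik j0] eq i j k by simp
  qed (use tensorsD(4)[OF A n k] tensorsD(4)[OF B n k] in auto)
qed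

lemma mod_twice:
  fixes x n :: nat
  shows "x < 2 * n \<Longrightarrow> x mod n = (if x < n then x else x - n)"
  by (simp add: mod_if)

lemma div_lt:
  fixes l b n :: nat
  assumes "l < b * n" shows "l div b < n"
  using assms by (simp add: less_mult_imp_div_less mult.commute)

lemma tprod_exists:
  assumes A: "A \<in> tensors a b n" and B: "B \<in> tensors b c n" and n: "0 < n"
  shows "\<exists>C \<in> tensors a c n. bcirc C = bcirc A * bcirc B"
proof -
  define P where "P = bcirc A * bcirc B"
  define C where "C = map (\<lambda>k. mat a c (\<lambda>(i, j). P $$ (k * a + i, j))) [0..<n]"
  have cA: "bcirc A \<in> carrier_mat (a * n) (b * n)" using bcirc_carrier[OF A n] .
  have cB: "bcirc B \<in> carrier_mat (b * n) (c * n)" using bcirc_carrier[OF B n] .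
  have cP: "P \<in> carrier_mat (a * n) (c * n)" using cA cB by (simp add: P_def)
  have C: "C \<in> tensors a c n" by (auto simp: C_def tensors_def)
  have P_index: "P $$ (i, j) = (\<Sum>l = 0..<b * n.
      A ! ((i div a + n - l div b) mod n) $$ (i mod a, l mod b) *
      B ! ((l div b + n - j div c) mod n) $$ (l mod b, j mod c))"
    if "i < a * n" "j < c * n" for i j
    using that cA cB
    by (auto simp: P_def scalar_prod_def bcirc_index[OF A n] bcirc_index[OF B n] intro!: sum.cong)
  have "bcirc C = P"
  proof (rule eq_matI)
    fix i j assume "i < dim_row P" "j < dim_col P"
    hence i: "i < a * n" and j: "j < c * n" using cP by auto
    define I where "I = i div a"
    define J where "J = j div c"
    define K where "K = (I + n - J) mod n"
    have I: "I < n" and J: "J < n" using i j by (auto simp: I_def J_def div_lt)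
    have K: "K < n" using n by (simp add: K_def)
    have a: "0 < a" and c: "0 < c" using i j by (auto intro: Nat.gr0I)
    have "bcirc C $$ (i, j) = C ! K $$ (i mod a, j mod c)"
      using bcirc_index[OF C n i j] by (simp add: K_def I_def J_def)
    also have "\<dots> = P $$ (K * a + i mod a, j mod c)"
      using K a c by (simp add: C_def)
    also have "\<dots> = (\<Sum>m = 0..<b * n.
      A ! ((K + n - m div b) mod n) $$ (i mod a, m mod b) *
      B ! ((m div b + n) mod n) $$ (m mod b, j mod c))"
      using P_index[of "K * a + i mod a" "j mod c"] block_index_less[OF K, of "i mod a" a]
        block_index_less[OF n, of "j mod c" c] a c by simp
    also have "\<dots> = (\<Sum>l = 0..<b * n.
      A ! ((I + n - l div b) mod n) $$ (i mod a, l mod b) *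
      B ! ((l div b + n - J) mod n) $$ (l mod b, j mod c))"
    proof (rule sum.reindex_bij_witness[where
          i = "\<lambda>l. ((l div b + n - J) mod n) * b + l mod b" and
          j = "\<lambda>m. ((m div b + J) mod n) * b + m mod b"], goal_cases)
      case (1 m)
      hence m: "m div b < n" and b: "0 < b" by (auto simp: div_lt intro: Nat.gr0I)
      have "((m div b + J) mod n + n - J) mod n = m div b"
        using m J by (auto simp: mod_twice)
      thus ?case using b by simp
    next
      case (2 m)
      hence b: "0 < b" by (auto intro: Nat.gr0I)
      show ?case using b n block_index_less[of "(m div b + J) mod n" n "m mod b" b] by simp
    next
      case (3 l)
      hence l: "l div b < n" and b: "0 < b" by (auto simp: div_lt intro: Nat.gr0I)
      have "((l div b + n - J) mod n + J) mod n = l div b"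
        using l J by (auto simp: mod_twice)
      thus ?case using b by simp
    next
      case (4 l)
      hence b: "0 < b" by (auto intro: Nat.gr0I)
      show ?case using b n block_index_less[of "(l div b + n - J) mod n" n "l mod b" b] by simp
    next
      case (5 m)
      hence m: "m div b < n" and b: "0 < b" by (auto simp: div_lt intro: Nat.gr0I)
      have 1: "((m div b + J) mod n + n - J) mod n = (m div b + n) mod n"
        using m J by (auto simp: mod_twice)
      have 2: "(I + n - (m div b + J) mod n) mod n = (K + n - m div b) mod n"
        using m I J by (auto simp: mod_twice K_def)
      show ?case using b 1 2 by simp
    qed
    also have "\<dots> = P $$ (i, j)" using P_index[OF i j] by (simp add: I_def J_def)
    finally show "bcirc C $$ (i, j) = P $$ (i, j)" .
  qed (use bcirc_carrier[OF C n] cP in auto)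
  thus ?thesis using C by (auto simp: P_def)
qed

lemma tprod:
  assumes A: "A \<in> tensors a b n" and B: "B \<in> tensors b c n" and n: "0 < n"
  shows tprod_closed: "A *\<^sub>t B \<in> tensors a c n"
    and bcirc_tprod: "bcirc (A *\<^sub>t B) = bcirc A * bcirc B"
proof -
  have "\<exists>!C. C \<in> tensors a c n \<and> bcirc C = bcirc A * bcirc B"
    using tprod_exists[OF A B n] bcirc_inj[OF _ _ n] by metis
  from theI'[OF this]
  show "A *\<^sub>t B \<in> tensors a c n" "bcirc (A *\<^sub>t B) = bcirc A * bcirc B"
    by (simp_all add: tprod_def tensorsD[OF A n] tensorsD[OF B n])
qed

end

theory Submission
  imports Defs
begin

text \<open>
  Write \<open>M\<close> for \<open>T *\<^sub>t S\<close>. All sets agree because each consists of the tensors \<open>Z *\<^sub>t T\<close>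
  with \<open>M *\<^sub>t Z *\<^sub>t T = T\<close>; call such a \<open>Z\<close> a \<^emph>\<open>solution\<close>. By the hypothesis
  \<open>T = M *\<^sub>t G *\<^sub>t T\<close> the tensor \<open>G\<close> is a solution, and everything is reduced to it.

  The step that is not plain algebra is that every \<open>{2}\<close>-inverse \<open>X\<close> of \<open>S\<close> with the null space of
  \<open>T\<close> is a left multiple of \<open>T\<close>. The multiplier has to be a tensor, that is, its matrix has to be
  block circulant, so a multiplier found by linear algebra from the inclusion of null spaces is not
  good enough. It can however be named explicitly: a right identity of \<open>T\<close> is a right
  identity of every tensor whose null space contains that of \<open>T\<close> (\<open>right_identity_transfer\<close>).
  Since \<open>S *\<^sub>t G *\<^sub>t T\<close> is a right identity of \<open>T\<close>, this gives \<open>X = X *\<^sub>t S *\<^sub>t G *\<^sub>t T\<close>, with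
  multiplier \<open>X *\<^sub>t S *\<^sub>t G\<close>. Transferring in the opposite direction, from \<open>X = X *\<^sub>t (S *\<^sub>t X)\<close>
  to \<open>T = T *\<^sub>t (S *\<^sub>t X)\<close>, shows that this multiplier is a solution.

  The rest is algebra. Solutions are exactly the \<open>{1}\<close>-inverses of \<open>M\<close>, because \<open>T\<close> and \<open>M\<close>
  are right multiples of each other: \<open>M = T *\<^sub>t S\<close> and \<open>T = M *\<^sub>t (G *\<^sub>t T)\<close>. In the last
  representation, \<open>G + Z - G *\<^sub>t M *\<^sub>t Z\<close> is a solution for every \<open>Z\<close>, and \<open>Z *\<^sub>t T\<close> is reproduced
  when \<open>Z\<close> already is one.
\<close>

section \<open>The algebra of tensors\<close>

lemma tprod_assoc:
  assumes A: "A \<in> tensors a b n" and B: "B \<in> tensors b c n" and C: "C \<in> tensors c d n"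
    and n: "0 < n"
  shows "A *\<^sub>t B *\<^sub>t C = A *\<^sub>t (B *\<^sub>t C)"
proof -
  note AB = tprod[OF A B n] and BC = tprod[OF B C n]
  note L = tprod[OF AB(1) C n] and R = tprod[OF A BC(1) n]
  show ?thesis
    by (rule bcirc_inj[OF L(1) R(1) n])
      (simp add: L(2) R(2) AB(2) BC(2)
        assoc_mult_mat[OF bcirc_carrier[OF A n] bcirc_carrier[OF B n] bcirc_carrier[OF C n]])
qed

lemma tadd_tdiff_closed:
  assumes "A \<in> tensors a b n" "B \<in> tensors a b n"
  shows tadd_closed: "A +\<^sub>t B \<in> tensors a b n"
    and tdiff_closed: "A -\<^sub>t B \<in> tensors a b n"
  using assms
  by (auto simp: tensors_def tadd_def tdiff_def set_zip subset_iff intro!: minus_carrier_mat)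

lemma bcirc_tadd_tdiff:
  assumes A: "A \<in> tensors a b n" and B: "B \<in> tensors a b n" and n: "0 < n"
  shows bcirc_tadd: "bcirc (A +\<^sub>t B) = bcirc A + bcirc B"
    and bcirc_tdiff: "bcirc (A -\<^sub>t B) = bcirc A - bcirc B"
proof -
  note cA = bcirc_carrier[OF A n] and cB = bcirc_carrier[OF B n]
  note P = tadd_closed[OF A B] and M = tdiff_closed[OF A B]
  have slice: "i mod a < a \<and> j mod b < b \<and> (i div a + n - j div b) mod n < n"
    if "i < a * n" "j < b * n" for i j
    using that n by (auto intro!: mod_less_divisor Nat.gr0I)
  note dims = tensorsD[OF A n] tensorsD[OF B n]
  have sliceB: "B ! m \<in> carrier_mat a b" if "m < n" for m
    using that dims by auto
  show "bcirc (A +\<^sub>t B) = bcirc A + bcirc B"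
  proof (rule eq_matI)
    fix i j assume "i < dim_row (bcirc A + bcirc B)" "j < dim_col (bcirc A + bcirc B)"
    hence i: "i < a * n" and j: "j < b * n" using cB by auto
    show "bcirc (A +\<^sub>t B) $$ (i, j) = (bcirc A + bcirc B) $$ (i, j)"
      unfolding bcirc_index[OF P n i j]
      using slice[OF i j] i j cA cB dims(1,5)
      by (simp add: bcirc_index[OF A n i j] bcirc_index[OF B n i j] tadd_def
          carrier_matD[OF sliceB])
  qed (use bcirc_carrier[OF P n] cB in auto)
  show "bcirc (A -\<^sub>t B) = bcirc A - bcirc B"
  proof (rule eq_matI)
    fix i j assume "i < dim_row (bcirc A - bcirc B)" "j < dim_col (bcirc A - bcirc B)"
    hence i: "i < a * n" and j: "j < b * n" using cB by auto
    show "bcirc (A -\<^sub>t B) $$ (i, j) = (bcirc A - bcirc B) $$ (i, j)"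
      unfolding bcirc_index[OF M n i j]
      using slice[OF i j] i j cA cB dims(1,5)
      by (simp add: bcirc_index[OF A n i j] bcirc_index[OF B n i j] tdiff_def
          carrier_matD[OF sliceB])
  qed (use bcirc_carrier[OF M n] cB in auto)
qed

lemma tadd_tdiff_cancel:
  assumes A: "A \<in> tensors a b n" and B: "B \<in> tensors a b n" and n: "0 < n"
  shows "A +\<^sub>t B -\<^sub>t B = A" and "A +\<^sub>t B -\<^sub>t A = B"
proof -
  note cA = bcirc_carrier[OF A n] and cB = bcirc_carrier[OF B n]
  note P = tadd_closed[OF A B]
  show "A +\<^sub>t B -\<^sub>t B = A"
    by (rule bcirc_inj[OF tdiff_closed[OF P B] A n], subst bcirc_tdiff[OF P B n],
        subst bcirc_tadd[OF A B n], rule eq_matI) (use cA cB in auto)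
  show "A +\<^sub>t B -\<^sub>t A = B"
    by (rule bcirc_inj[OF tdiff_closed[OF P A] B n], subst bcirc_tdiff[OF P A n],
        subst bcirc_tadd[OF A B n], rule eq_matI) (use cA cB in auto)
qed

text \<open>
  Only sums of the shape occurring in the last representation are needed, so addition and
  subtraction are distributed over in one go.
\<close>

lemma tprod_distrib_left:
  assumes A: "A \<in> tensors a b n" and B: "B \<in> tensors b c n" and C: "C \<in> tensors b c n"
    and D: "D \<in> tensors b c n" and n: "0 < n"
  shows "A *\<^sub>t (B +\<^sub>t C -\<^sub>t D) = A *\<^sub>t B +\<^sub>t A *\<^sub>t C -\<^sub>t A *\<^sub>t D"
proof -
  note BC = tadd_closed[OF B C]
  note BCD = tdiff_closed[OF BC D]
  note AB = tprod[OF A B n] and AC = tprod[OF A C n] and AD = tprod[OF A D n]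
  note S = tadd_closed[OF AB(1) AC(1)]
  note c = bcirc_carrier[OF A n] bcirc_carrier[OF B n] bcirc_carrier[OF C n] bcirc_carrier[OF D n]
  show ?thesis
    by (rule bcirc_inj[OF tprod_closed[OF A BCD n] tdiff_closed[OF S AD(1)] n])
      (use c in \<open>simp add: bcirc_tprod[OF A BCD n] bcirc_tdiff[OF BC D n] bcirc_tadd[OF B C n]
        bcirc_tdiff[OF S AD(1) n] bcirc_tadd[OF AB(1) AC(1) n] AB(2) AC(2) AD(2)
        mult_minus_distrib_mat[where nr="a*n" and n="b*n" and nc="c*n"]
        mult_add_distrib_mat[where nr="a*n" and n="b*n" and nc="c*n"]\<close>)
qed

lemma tprod_distrib_right:
  assumes A: "A \<in> tensors b c n" and B: "B \<in> tensors a b n" and C: "C \<in> tensors a b n"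
    and D: "D \<in> tensors a b n" and n: "0 < n"
  shows "(B +\<^sub>t C -\<^sub>t D) *\<^sub>t A = B *\<^sub>t A +\<^sub>t C *\<^sub>t A -\<^sub>t D *\<^sub>t A"
proof -
  note BC = tadd_closed[OF B C]
  note BCD = tdiff_closed[OF BC D]
  note BA = tprod[OF B A n] and CA = tprod[OF C A n] and DA = tprod[OF D A n]
  note S = tadd_closed[OF BA(1) CA(1)]
  note c = bcirc_carrier[OF A n] bcirc_carrier[OF B n] bcirc_carrier[OF C n] bcirc_carrier[OF D n]
  show ?thesis
    by (rule bcirc_inj[OF tprod_closed[OF BCD A n] tdiff_closed[OF S DA(1)] n])
      (use c in \<open>simp add: bcirc_tprod[OF BCD A n] bcirc_tdiff[OF BC D n] bcirc_tadd[OF B C n]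
        bcirc_tdiff[OF S DA(1) n] bcirc_tadd[OF BA(1) CA(1) n] BA(2) CA(2) DA(2)
        minus_mult_distrib_mat[where nr="a*n" and n="b*n" and nc="c*n"]
        add_mult_distrib_mat[where nr="a*n" and n="b*n" and nc="c*n"]\<close>)
qed

section \<open>Null spaces\<close>

text \<open>
  If \<open>A = A * E\<close>, then every \<open>v - E v\<close> lies in the kernel of \<open>A\<close>, hence in that of \<open>B\<close>; let
  \<open>v\<close> run through the unit vectors.
\<close>

lemma right_identity_transfer_mat:
  fixes A B E :: "'a :: comm_ring_1 mat"
  assumes A: "A \<in> carrier_mat r m" and B: "B \<in> carrier_mat s m" and E: "E \<in> carrier_mat m m"
    and ker: "mat_kernel A \<subseteq> mat_kernel B" and AE: "A = A * E"
  shows "B = B * E"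
proof (rule eq_matI)
  fix i j assume "i < dim_row (B * E)" "j < dim_col (B * E)"
  hence i: "i < s" and j: "j < m" using B E by auto
  define v where "v = unit_vec m j - col E j"
  have col: "X *\<^sub>v v = col X j - col (X * E) j" if X: "X \<in> carrier_mat t m" for X t
  proof -
    have "X *\<^sub>v v = X *\<^sub>v unit_vec m j - X *\<^sub>v col E j"
      unfolding v_def using X E by (intro mult_minus_distrib_mat_vec) auto
    moreover have "X *\<^sub>v unit_vec m j = col X j"
      using X j col_mult2[OF X one_carrier_mat j] by simp
    moreover have "X *\<^sub>v col E j = col (X * E) j"
      by (rule col_mult2[OF X E j, symmetric])
    ultimately show ?thesis by simp
  qed
  have "v \<in> mat_kernel A"
    using A E col[OF A] AE by (auto simp: mat_kernel_def v_def)
  hence "v \<in> mat_kernel B" using ker by blast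
  hence "col B j - col (B * E) j = 0\<^sub>v s"
    using col[OF B] B by (simp add: mat_kernel_def)
  hence "(col B j - col (B * E) j) $ i = 0" using i by simp
  thus "B $$ (i, j) = (B * E) $$ (i, j)" using i j B E by simp
qed (use B E in auto)

lemma right_identity_transfer:
  assumes A: "A \<in> tensors a m n" and B: "B \<in> tensors b m n" and E: "E \<in> tensors m m n"
    and n: "0 < n" and null: "t_null A \<subseteq> t_null B" and AE: "A = A *\<^sub>t E"
  shows "B = B *\<^sub>t E"
proof -
  have "bcirc A = bcirc A * bcirc E" using AE bcirc_tprod[OF A E n] by simp
  hence "bcirc B = bcirc B * bcirc E"
    using right_identity_transfer_mat bcirc_carrier[OF A n] bcirc_carrier[OF B n]
      bcirc_carrier[OF E n] null unfolding t_null_def by blast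
  thus ?thesis
    using bcirc_inj[OF B tprod_closed[OF B E n] n] bcirc_tprod[OF B E n] by simp
qed

lemma t_null_tprod:
  assumes A: "A \<in> tensors a b n" and B: "B \<in> tensors b c n" and n: "0 < n"
  shows "t_null B \<subseteq> t_null (A *\<^sub>t B)"
  unfolding t_null_def bcirc_tprod[OF A B n]
  using mat_kernel_mult_subset[OF bcirc_carrier[OF B n] bcirc_carrier[OF A n]] .

section \<open>Representations of the inverses with prescribed null space\<close>

text \<open>
  The hypothesis \<open>T = T *\<^sub>t S *\<^sub>t G *\<^sub>t T\<close> says that \<open>T\<close> is a right multiple of \<open>T *\<^sub>t S\<close>, so
  that \<open>T *\<^sub>t S\<close> can be replaced by \<open>T\<close> at the right end of \<open>T *\<^sub>t S *\<^sub>t Z *\<^sub>t (T *\<^sub>t S) = T *\<^sub>t S\<close>.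
\<close>

lemma one_inverses_iff:
  assumes n: "0 < n" and S: "S \<in> tensors p q n" and T: "T \<in> tensors k p n"
    and G: "G \<in> tensors q k n" and TG: "T = T *\<^sub>t S *\<^sub>t G *\<^sub>t T"
  shows "Z \<in> one_inverses (T *\<^sub>t S) \<longleftrightarrow> Z \<in> tensors q k n \<and> T *\<^sub>t S *\<^sub>t Z *\<^sub>t T = T"
proof (cases "Z \<in> tensors q k n")
  case Z: True
  note M = tprod_closed[OF T S n]
  note GT = tprod_closed[OF G T n] and MZ = tprod_closed[OF M Z n]
  note MZT = tprod_closed[OF MZ T n]
  have "T *\<^sub>t S *\<^sub>t Z *\<^sub>t T = T" if eq: "T *\<^sub>t S *\<^sub>t Z *\<^sub>t (T *\<^sub>t S) = T *\<^sub>t S"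
  proof -
    have T': "T = T *\<^sub>t S *\<^sub>t (G *\<^sub>t T)" using TG tprod_assoc[OF M G T n] by simp
    hence "T *\<^sub>t S *\<^sub>t Z *\<^sub>t T = T *\<^sub>t S *\<^sub>t Z *\<^sub>t (T *\<^sub>t S *\<^sub>t (G *\<^sub>t T))" by simp
    also have "\<dots> = T *\<^sub>t S *\<^sub>t (G *\<^sub>t T)"
      using tprod_assoc[OF MZ M GT n] eq by simp
    finally show ?thesis using T' by simp
  qed
  moreover have "T *\<^sub>t S *\<^sub>t Z *\<^sub>t (T *\<^sub>t S) = T *\<^sub>t S" if "T *\<^sub>t S *\<^sub>t Z *\<^sub>t T = T"
    using tprod_assoc[OF MZ T S n] that by simp
  ultimately show ?thesis
    using Z tensorsD[OF M n] by (auto simp: one_inverses_def)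
qed (use tensorsD[OF tprod_closed[OF T S n] n] in \<open>simp add: one_inverses_def\<close>)

lemma two_inverses_null_eq_solutions:
  assumes n: "0 < n" and S: "S \<in> tensors p q n" and T: "T \<in> tensors k p n"
    and G: "G \<in> tensors q k n" and TG: "T = T *\<^sub>t S *\<^sub>t G *\<^sub>t T"
  shows "two_inverses_null S T
    = {Z *\<^sub>t T | Z. Z \<in> tensors q k n \<and> T *\<^sub>t S *\<^sub>t Z *\<^sub>t T = T}" (is "?L = ?R")
proof
  note M = tprod_closed[OF T S n] and SG = tprod_closed[OF S G n] and GT = tprod_closed[OF G T n]
  note SGT = tprod_closed[OF S GT n]
  show "?L \<subseteq> ?R"
  proof
    fix X assume "X \<in> ?L"
    hence X: "X \<in> tensors q p n" and XSX: "X *\<^sub>t S *\<^sub>t X = X" and null: "t_null X = t_null T"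
      using tensorsD[OF S n] by (auto simp: two_inverses_null_def)
    note XS = tprod_closed[OF X S n] and SX = tprod_closed[OF S X n]
    note XSG = tprod_closed[OF XS G n]
    have "T = T *\<^sub>t (S *\<^sub>t (G *\<^sub>t T))"
      using TG tprod_assoc[OF M G T n] tprod_assoc[OF T S GT n] by simp
    from right_identity_transfer[OF T X SGT n _ this]
    have "X = X *\<^sub>t (S *\<^sub>t (G *\<^sub>t T))" using null by simp
    hence X_eq: "X = X *\<^sub>t S *\<^sub>t G *\<^sub>t T"
      using tprod_assoc[OF X S GT n] tprod_assoc[OF XS G T n] by simp
    have "X = X *\<^sub>t (S *\<^sub>t X)" using XSX tprod_assoc[OF X S X n] by simp
    from right_identity_transfer[OF X T SX n _ this]
    have "T = T *\<^sub>t (S *\<^sub>t X)" using null by simp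
    hence TSX: "T = T *\<^sub>t S *\<^sub>t X" using tprod_assoc[OF T S X n] by simp
    have "T *\<^sub>t S *\<^sub>t (X *\<^sub>t S *\<^sub>t G) *\<^sub>t T = T *\<^sub>t S *\<^sub>t (X *\<^sub>t S *\<^sub>t G *\<^sub>t T)"
      by (rule tprod_assoc[OF M XSG T n])
    also have "\<dots> = T" using X_eq TSX by simp
    finally show "X \<in> ?R" using X_eq XSG by blast
  qed
  show "?R \<subseteq> ?L"
  proof
    fix X assume "X \<in> ?R"
    then obtain Z where X_def: "X = Z *\<^sub>t T" and Z: "Z \<in> tensors q k n"
      and sol: "T *\<^sub>t S *\<^sub>t Z *\<^sub>t T = T" by blast
    note ZT = tprod_closed[OF Z T n]
    have TSZT: "T *\<^sub>t S *\<^sub>t (Z *\<^sub>t T) = T" using sol tprod_assoc[OF M Z T n] by simp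
    have "Z *\<^sub>t T *\<^sub>t S *\<^sub>t (Z *\<^sub>t T) = Z *\<^sub>t T"
      using tprod_assoc[OF Z T S n] tprod_assoc[OF Z M ZT n] TSZT by simp
    moreover have "t_null (Z *\<^sub>t T) = t_null T"
      using t_null_tprod[OF Z T n] t_null_tprod[OF M ZT n] TSZT by auto
    ultimately show "X \<in> ?L"
      using X_def ZT tensorsD[OF S n] by (simp add: two_inverses_null_def)
  qed
qed

text \<open>
  On left multiples \<open>W\<close> of \<open>T\<close>, the affine map that sends \<open>W\<close> to
  \<open>G *\<^sub>t T +\<^sub>t W -\<^sub>t G *\<^sub>t T *\<^sub>t S *\<^sub>t W\<close> is idempotent, and its fixed points are the \<open>W\<close> with
  \<open>T *\<^sub>t S *\<^sub>t W = T\<close>. If \<open>W\<close> is such, then the subtracted term cancels \<open>G *\<^sub>t T\<close>; for arbitrary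
  \<open>W\<close>, it cancels \<open>W\<close> after multiplication by \<open>T *\<^sub>t S\<close>.
\<close>

lemma solutions_affine_representation:
  assumes n: "0 < n" and S: "S \<in> tensors p q n" and T: "T \<in> tensors k p n"
    and G: "G \<in> tensors q k n" and TG: "T = T *\<^sub>t S *\<^sub>t G *\<^sub>t T"
  shows "{Z *\<^sub>t T | Z. Z \<in> tensors q k n \<and> T *\<^sub>t S *\<^sub>t Z *\<^sub>t T = T}
    = {G *\<^sub>t T +\<^sub>t Z *\<^sub>t T -\<^sub>t G *\<^sub>t T *\<^sub>t S *\<^sub>t Z *\<^sub>t T | Z. Z \<in> tensors q k n}" (is "?L = ?R")
proof
  note M = tprod_closed[OF T S n] and GT = tprod_closed[OF G T n]
  note MG = tprod_closed[OF M G n]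
  show "?L \<subseteq> ?R"
  proof
    fix X assume "X \<in> ?L"
    then obtain Z where X: "X = Z *\<^sub>t T" and Z: "Z \<in> tensors q k n"
      and sol: "T *\<^sub>t S *\<^sub>t Z *\<^sub>t T = T" by blast
    note ZT = tprod_closed[OF Z T n] and MZ = tprod_closed[OF M Z n]
    have "G *\<^sub>t T *\<^sub>t S *\<^sub>t Z *\<^sub>t T = G *\<^sub>t (T *\<^sub>t S *\<^sub>t Z *\<^sub>t T)"
      using tprod_assoc[OF G T S n] tprod_assoc[OF G M Z n] tprod_assoc[OF G MZ T n] by simp
    hence "X = G *\<^sub>t T +\<^sub>t Z *\<^sub>t T -\<^sub>t G *\<^sub>t T *\<^sub>t S *\<^sub>t Z *\<^sub>t T"
      using X sol tadd_tdiff_cancel(2)[OF GT ZT n] by simp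
    thus "X \<in> ?R" using Z by blast
  qed
  show "?R \<subseteq> ?L"
  proof
    fix X assume "X \<in> ?R"
    then obtain Z where X: "X = G *\<^sub>t T +\<^sub>t Z *\<^sub>t T -\<^sub>t G *\<^sub>t T *\<^sub>t S *\<^sub>t Z *\<^sub>t T"
      and Z: "Z \<in> tensors q k n" by blast
    note ZT = tprod_closed[OF Z T n] and MZ = tprod_closed[OF M Z n]
    note MZT = tprod_closed[OF MZ T n]
    define H where "H = G *\<^sub>t T *\<^sub>t S *\<^sub>t Z"
    define Y where "Y = G +\<^sub>t Z -\<^sub>t H"
    have H_eq: "H = G *\<^sub>t (T *\<^sub>t S *\<^sub>t Z)"
      unfolding H_def using tprod_assoc[OF G T S n] tprod_assoc[OF G M Z n] by simp
    have H: "H \<in> tensors q k n" unfolding H_eq by (rule tprod_closed[OF G MZ n])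
    note HT = tprod_closed[OF H T n]
    have Y: "Y \<in> tensors q k n"
      unfolding Y_def by (rule tdiff_closed[OF tadd_closed[OF G Z] H])
    have X_eq: "X = Y *\<^sub>t T"
      unfolding X Y_def tprod_distrib_right[OF T G Z H n] by (simp add: H_def)
    have "T *\<^sub>t S *\<^sub>t (H *\<^sub>t T) = T *\<^sub>t S *\<^sub>t (G *\<^sub>t (T *\<^sub>t S *\<^sub>t (Z *\<^sub>t T)))"
      using H_eq tprod_assoc[OF G MZ T n] tprod_assoc[OF M Z T n] by simp
    also have "\<dots> = T *\<^sub>t S *\<^sub>t G *\<^sub>t T *\<^sub>t S *\<^sub>t (Z *\<^sub>t T)"
      using tprod_assoc[OF M G tprod_closed[OF M ZT n] n] tprod_assoc[OF MG M ZT n]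
        tprod_assoc[OF MG T S n] by simp
    finally have MHT: "T *\<^sub>t S *\<^sub>t (H *\<^sub>t T) = T *\<^sub>t S *\<^sub>t (Z *\<^sub>t T)" using TG by simp
    have MGT: "T *\<^sub>t S *\<^sub>t (G *\<^sub>t T) = T" using TG tprod_assoc[OF M G T n] by simp
    have "T *\<^sub>t S *\<^sub>t Y *\<^sub>t T = T *\<^sub>t S *\<^sub>t (G *\<^sub>t T +\<^sub>t Z *\<^sub>t T -\<^sub>t H *\<^sub>t T)"
      using tprod_assoc[OF M Y T n] tprod_distrib_right[OF T G Z H n] by (simp add: Y_def)
    also have "\<dots> = T +\<^sub>t T *\<^sub>t S *\<^sub>t (Z *\<^sub>t T) -\<^sub>t T *\<^sub>t S *\<^sub>t (Z *\<^sub>t T)"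
      using tprod_distrib_left[OF M GT ZT HT n] MGT MHT by simp
    also have "\<dots> = T"
      by (rule tadd_tdiff_cancel(1)[OF T tprod_closed[OF M ZT n] n])
    finally show "X \<in> ?L" using X_eq Y by blast
  qed
qed

theorem theorem3p8:
  fixes n p q k :: nat and S T G :: tensor
  assumes n: "0 < n"
    and S: "S \<in> tensors p q n"
    and T: "T \<in> tensors k p n"
    and G: "G \<in> one_inverses (T *\<^sub>t S)"
    and a: "\<exists>X \<in> tensors q p n. X *\<^sub>t S *\<^sub>t X = X \<and> t_null X = t_null T"
    and b: "\<exists>Z \<in> tensors q k n. T = T *\<^sub>t S *\<^sub>t Z *\<^sub>t T"
    and c: "t_range (T *\<^sub>t S) = t_range T"
    and d: "T = T *\<^sub>t S *\<^sub>t G *\<^sub>t T"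
    and e: "t_rank (T *\<^sub>t S) = t_rank T"
  shows "two_inverses_null S T = {Y *\<^sub>t T | Y. Y \<in> one_inverses (T *\<^sub>t S)}
       \<and> {Y *\<^sub>t T | Y. Y \<in> one_inverses (T *\<^sub>t S)}
           = {Z *\<^sub>t T | Z. Z \<in> tensors q k n \<and> T *\<^sub>t S *\<^sub>t Z *\<^sub>t T = T}
       \<and> two_inverses_null S T
           = {G *\<^sub>t T +\<^sub>t Z *\<^sub>t T -\<^sub>t G *\<^sub>t T *\<^sub>t S *\<^sub>t Z *\<^sub>t T | Z. Z \<in> tensors q k n}"
proof -
  have G': "G \<in> tensors q k n"
    using G tensorsD[OF tprod_closed[OF T S n] n] by (simp add: one_inverses_def)
  have "{Y *\<^sub>t T | Y. Y \<in> one_inverses (T *\<^sub>t S)}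
      = {Z *\<^sub>t T | Z. Z \<in> tensors q k n \<and> T *\<^sub>t S *\<^sub>t Z *\<^sub>t T = T}"
    by (simp only: one_inverses_iff[OF n S T G' d])
  with two_inverses_null_eq_solutions[OF n S T G' d] solutions_affine_representation[OF n S T G' d]
  show ?thesis by simp
qed

end
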